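(* Let $H_2\subset H_1$ be separable Hilbert spaces with a dense inclusion of $H_2$ into $H_1$. Let $U_1,V_1\subset H_1$ be open subsets and let $\phi\colon U_1\to V_1$ and $\psi\colon V_1\to H_1$ be $(H_1,H_2)$-tame maps. Then the composition $\psi\circ\phi\colon U_1\to H_1$ is $(H_1,H_2)$-tame as well.
   Context: Norms are $|\cdot|_1:=\|\cdot\|_{H_1}$, $|\cdot|_2:=\|\cdot\|_{H_2}$, normalized so that $|\cdot|_1\le|\cdot|_2$ on $H_2$. For $U_1\subset H_1$ open and $U_2:=U_1\cap H_2$, a $C^2$ map $\phi\colon U_1\to H_1$ is *$(H_1,H_2)$-tame* if (i) $\phi(U_2)\subset H_2$ and $\phi|_{U_2}\colon U_2\to H_2$ is $C^2$; (ii) for every $x\in U_1$ there are an $H_1$-open neighborhood $W_x\subset U_1$ of $x$ and a constant $\kappa>0$ such that for all $y\in W_x\cap H_2$ and all $\xi,\eta\in H_2$: $|d^2\phi|_y(\xi,\eta)|_2\le\kappa\big(|\xi|_1|\eta|_2+|\xi|_2|\eta|_1+|y|_2|\xi|_1|\eta|_1\big)$. A map $U_1\to V_1\subset H_1$ is called tame if it is tame as a map to $H_1$. *)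

theory Defs
  imports "HOL-Analysis.Analysis"
begin

text \<open>
  The derivative as a bounded operator, so that it can be differentiated again and its continuity
  refers to the operator norm. Meaningful at points where \<open>f\<close> is Frechet differentiable.
\<close>
definition fderiv ::
    "('a::real_normed_vector \<Rightarrow> 'b::real_normed_vector) \<Rightarrow> 'a \<Rightarrow> 'a \<Rightarrow>\<^sub>L 'b" where
  "fderiv f x = Blinfun (frechet_derivative f (at x))"

definition fderiv2 ::
    "('a::real_normed_vector \<Rightarrow> 'b::real_normed_vector) \<Rightarrow> 'a \<Rightarrow> 'a \<Rightarrow> 'a \<Rightarrow> 'b" where
  "fderiv2 f x \<xi> \<eta> = blinfun_apply (blinfun_apply (fderiv (fderiv f) x) \<xi>) \<eta>"

text \<open>To be used for open \<open>U\<close>: the derivatives are unrestricted ones, which at points of an open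
  \<open>U\<close> depend only on the values of \<open>f\<close> on \<open>U\<close>.\<close>
definition C2_on ::
    "'a set \<Rightarrow> ('a::real_normed_vector \<Rightarrow> 'b::real_normed_vector) \<Rightarrow> bool" where
  "C2_on U f \<longleftrightarrow>
     (\<forall>x\<in>U. f differentiable at x) \<and>
     (\<forall>x\<in>U. fderiv f differentiable at x) \<and>
     continuous_on U (fderiv (fderiv f))"

text \<open>
  The inclusion of \<open>H\<^sub>2\<close> into \<open>H\<^sub>1\<close> is an injective map \<open>\<iota> :: 'h2 \<Rightarrow> 'h1\<close> between the two
  Hilbert spaces, so \<open>|x|\<^sub>1\<close> is \<open>norm (\<iota> x)\<close> and \<open>|x|\<^sub>2\<close> is \<open>norm x\<close> for \<open>x :: 'h2\<close>, and
  \<open>U \<inter> H\<^sub>2\<close> is \<open>U \<inter> range \<iota>\<close> as a subset of \<open>H\<^sub>1\<close> and \<open>\<iota> -` U\<close> as an open subset of \<open>H\<^sub>2\<close>.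
  The following is \<open>\<phi>\<close> on \<open>U \<inter> H\<^sub>2\<close>, as a map to \<open>H\<^sub>2\<close>; it is meaningful once \<open>\<phi>\<close> maps
  \<open>U \<inter> H\<^sub>2\<close> into \<open>H\<^sub>2\<close>.
\<close>
definition restr2 :: "('h2 \<Rightarrow> 'h1) \<Rightarrow> ('h1 \<Rightarrow> 'h1) \<Rightarrow> 'h2 \<Rightarrow> 'h2" where
  "restr2 \<iota> \<phi> y = inv \<iota> (\<phi> (\<iota> y))"

text \<open>
  The second derivative in the estimate is that of the map to \<open>H\<^sub>2\<close>. Lemma \<open>tame_fderiv2\<close> below
  shows that it agrees with the second derivative of \<open>\<phi>\<close> as a map to \<open>H\<^sub>1\<close>.
\<close>
definition tame ::
    "('h2::real_inner \<Rightarrow> 'h1::real_inner) \<Rightarrow> 'h1 set \<Rightarrow> ('h1 \<Rightarrow> 'h1) \<Rightarrow> bool" where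
  "tame \<iota> U \<phi> \<longleftrightarrow>
     C2_on U \<phi> \<and>
     \<phi> ` (U \<inter> range \<iota>) \<subseteq> range \<iota> \<and>
     C2_on (\<iota> -` U) (restr2 \<iota> \<phi>) \<and>
     (\<forall>x\<in>U. \<exists>W \<kappa>. open W \<and> x \<in> W \<and> W \<subseteq> U \<and> \<kappa> > 0 \<and>
        (\<forall>y \<xi> \<eta>. \<iota> y \<in> W \<longrightarrow>
           norm (fderiv2 (restr2 \<iota> \<phi>) y \<xi> \<eta>)
             \<le> \<kappa> * (norm (\<iota> \<xi>) * norm \<eta> + norm \<xi> * norm (\<iota> \<eta>)
                     + norm y * norm (\<iota> \<xi>) * norm (\<iota> \<eta>))))"

lemma fderiv_has_derivative:
  assumes "f differentiable at x"
  shows "(f has_derivative blinfun_apply (fderiv f x)) (at x)"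
proof -
  have d: "(f has_derivative frechet_derivative f (at x)) (at x)"
    using assms by (simp add: frechet_derivative_works)
  then have "bounded_linear (frechet_derivative f (at x))"
    by (rule has_derivative_bounded_linear)
  then show ?thesis
    using d by (simp add: fderiv_def bounded_linear_Blinfun_apply)
qed

lemma tame_fderiv2:
  fixes \<iota> :: "'h2::real_inner \<Rightarrow> 'h1::real_inner"
  assumes bl: "bounded_linear \<iota>" and "inj \<iota>" and U: "open U" and t: "tame \<iota> U \<phi>"
    and y: "\<iota> y \<in> U"
  shows "\<iota> (fderiv2 (restr2 \<iota> \<phi>) y \<xi> \<eta>) = fderiv2 \<phi> (\<iota> y) (\<iota> \<xi>) (\<iota> \<eta>)"
proof -
  let ?r = "restr2 \<iota> \<phi>"
  have op: "open (\<iota> -` U)"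
    using U bl by (intro open_vimage) (auto intro: linear_continuous_on)
  have eq: "\<iota> (?r z) = \<phi> (\<iota> z)" if "z \<in> \<iota> -` U" for z
    using t that by (auto simp: tame_def restr2_def intro!: f_inv_into_f)
  have i: "(\<iota> has_derivative \<iota>) (at z)" for z
    by (rule bounded_linear_imp_has_derivative[OF bl])
  have 1: "\<iota> (blinfun_apply (fderiv ?r z) \<eta>) = blinfun_apply (fderiv \<phi> (\<iota> z)) (\<iota> \<eta>)"
    if z: "z \<in> \<iota> -` U" for z \<eta>
  proof -
    have a: "(?r has_derivative blinfun_apply (fderiv ?r z)) (at z)"
      "(\<phi> has_derivative blinfun_apply (fderiv \<phi> (\<iota> z))) (at (\<iota> z))"
      using t z by (auto intro!: fderiv_has_derivative simp: tame_def C2_on_def)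
    have "((\<lambda>w. \<iota> (?r w)) has_derivative (\<lambda>h. \<iota> (blinfun_apply (fderiv ?r z) h))) (at z)"
      by (rule bounded_linear.has_derivative[OF bl a(1)])
    moreover have "((\<lambda>w. \<phi> (\<iota> w)) has_derivative
        (\<lambda>h. blinfun_apply (fderiv \<phi> (\<iota> z)) (\<iota> h))) (at z)"
      by (rule has_derivative_compose[OF i a(2)])
    then have "((\<lambda>w. \<iota> (?r w)) has_derivative
        (\<lambda>h. blinfun_apply (fderiv \<phi> (\<iota> z)) (\<iota> h))) (at z)"
      by (rule has_derivative_transform_within_open[OF _ op z]) (simp add: eq)
    ultimately show ?thesis
      by (blast dest: has_derivative_unique fun_cong)
  qed
  have y': "y \<in> \<iota> -` U" using y by simp
  have a: "(fderiv ?r has_derivative blinfun_apply (fderiv (fderiv ?r) y)) (at y)"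
    "(fderiv \<phi> has_derivative blinfun_apply (fderiv (fderiv \<phi>) (\<iota> y))) (at (\<iota> y))"
    using t y by (auto intro!: fderiv_has_derivative simp: tame_def C2_on_def)
  have "((\<lambda>w. \<iota> (blinfun_apply (fderiv ?r w) \<eta>)) has_derivative
      (\<lambda>h. \<iota> (blinfun_apply (blinfun_apply (fderiv (fderiv ?r) y) h) \<eta>))) (at y)"
    by (intro bounded_linear.has_derivative[OF bl]
        bounded_linear.has_derivative[OF blinfun.bounded_linear_left] a)
  moreover have "((\<lambda>w. blinfun_apply (fderiv \<phi> (\<iota> w)) (\<iota> \<eta>)) has_derivative
      (\<lambda>h. blinfun_apply (blinfun_apply (fderiv (fderiv \<phi>) (\<iota> y)) (\<iota> h)) (\<iota> \<eta>))) (at y)"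
    by (intro bounded_linear.has_derivative[OF blinfun.bounded_linear_left]
        has_derivative_compose[OF i a(2)])
  then have "((\<lambda>w. \<iota> (blinfun_apply (fderiv ?r w) \<eta>)) has_derivative
      (\<lambda>h. blinfun_apply (blinfun_apply (fderiv (fderiv \<phi>) (\<iota> y)) (\<iota> h)) (\<iota> \<eta>))) (at y)"
    by (rule has_derivative_transform_within_open[OF _ op y']) (simp add: 1)
  ultimately show ?thesis
    unfolding fderiv2_def by (blast dest: has_derivative_unique fun_cong)
qed

end

theory Submission
  imports Defs
begin

text \<open>
  In \<open>H\<^sub>2\<close> the second derivative of the composition is
  \<open>d\<^sup>2\<psi>(d\<phi> \<xi>, d\<phi> \<eta>) + d\<psi> (d\<^sup>2\<phi>(\<xi>, \<eta>))\<close>. Near a point of \<open>H\<^sub>1\<close>, integrating the tameness estimate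
  along segments that start at an auxiliary point of the dense subspace \<open>H\<^sub>2\<close> gives
  \<open>|d\<phi>\<^sub>y \<xi>|\<^sub>2 \<le> C (|\<xi>|\<^sub>2 + |y|\<^sub>2 |\<xi>|\<^sub>1)\<close>, and integrating once more gives \<open>|\<phi>(y)|\<^sub>2 \<le> C (1 + |y|\<^sub>2)\<close>, with
  constants that do not depend on \<open>|y|\<^sub>2\<close>. Together with the local boundedness of the derivatives
  in \<open>H\<^sub>1\<close> this bounds both summands.
\<close>

section \<open>Twice continuously differentiable maps\<close>

lemma fderiv_eqI:
  assumes "(f has_derivative blinfun_apply F) (at x)"
  shows "fderiv f x = F"
  by (simp add: fderiv_def frechet_derivative_at[OF assms, symmetric] blinfun_apply_inverse)

lemma fderiv_cong_open:
  assumes "open U" "x \<in> U" "\<And>z. z \<in> U \<Longrightarrow> f z = g z" "f differentiable at x"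
  shows "g differentiable at x" "fderiv g x = fderiv f x"
proof -
  have "(g has_derivative blinfun_apply (fderiv f x)) (at x)"
    using fderiv_has_derivative[OF assms(4)] assms(1-3)
    by (rule has_derivative_transform_within_open)
  then show "g differentiable at x" "fderiv g x = fderiv f x"
    by (auto simp: differentiable_def intro: fderiv_eqI)
qed

text \<open>First-order locality applies twice, since the derivatives agree on the whole open set
  and not just at \<open>x\<close>. This is for \<open>restr2\<close>: the inverse
  \<open>inv \<iota>\<close> is meaningful only on the range, so restricting a composite and
  composing the restrictions are compared only on an open preimage.\<close>

lemma fderiv_fderiv_cong_open:
  assumes U: "open U" and eq: "\<And>z. z \<in> U \<Longrightarrow> f z = g z" and f: "C2_on U f" and x: "x \<in> U"
  shows "fderiv g differentiable at x" "fderiv (fderiv g) x = fderiv (fderiv f) x"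
proof -
  have "fderiv f z = fderiv g z" if "z \<in> U" for z
    using fderiv_cong_open(2)[OF U that eq] f that by (simp add: C2_on_def)
  from fderiv_cong_open[OF U x this]
  show "fderiv g differentiable at x" "fderiv (fderiv g) x = fderiv (fderiv f) x"
    using f x by (auto simp: C2_on_def)
qed

lemma C2_on_cong_open:
  assumes U: "open U" and eq: "\<And>z. z \<in> U \<Longrightarrow> f z = g z" and f: "C2_on U f"
  shows "C2_on U g"
  unfolding C2_on_def
proof (intro conjI ballI)
  fix x assume "x \<in> U"
  then show "g differentiable at x"
    using fderiv_cong_open(1)[OF U _ eq] f by (simp add: C2_on_def)
  show "fderiv g differentiable at x"
    using fderiv_fderiv_cong_open(1)[OF U eq f \<open>x \<in> U\<close>] .
next
  have "continuous_on U (fderiv (fderiv f))"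
    using f by (simp add: C2_on_def)
  then show "continuous_on U (fderiv (fderiv g))"
    by (rule continuous_on_eq) (simp add: fderiv_fderiv_cong_open(2)[OF U eq f])
qed

section \<open>Second-order chain rule, mean value inequality and local bounds\<close>

lemma C2_on_imp_continuous_on:
  assumes "C2_on U f"
  shows "continuous_on U f" "continuous_on U (fderiv f)"
  using assms
  by (auto simp: C2_on_def intro!: continuous_at_imp_continuous_on differentiable_imp_continuous_within)

text \<open>The first derivative is a composition of bounded operators, which is a bounded bilinear
  operation. The product rule for it, with the chain rule in the factor
  \<open>fderiv g (f z)\<close>, gives the second derivative.\<close>

lemma C2_on_compose:
  assumes U: "open U" and f: "C2_on U f" and g: "C2_on V g" and fUV: "f ` U \<subseteq> V"
  shows "C2_on U (g \<circ> f)"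
    and "x \<in> U \<Longrightarrow> fderiv2 (g \<circ> f) x \<xi> \<eta> =
      fderiv2 g (f x) (fderiv f x \<xi>) (fderiv f x \<eta>) + fderiv g (f x) (fderiv2 f x \<xi> \<eta>)"
proof -
  interpret c: bounded_bilinear "blinfun_compose :: 'b \<Rightarrow>\<^sub>L 'c \<Rightarrow> 'a \<Rightarrow>\<^sub>L 'b \<Rightarrow> 'a \<Rightarrow>\<^sub>L 'c"
    by (rule bounded_bilinear_blinfun_compose)
  have df: "(f has_derivative blinfun_apply (fderiv f z)) (at z)"
    and ddf: "(fderiv f has_derivative blinfun_apply (fderiv (fderiv f) z)) (at z)"
    and dg: "(g has_derivative blinfun_apply (fderiv g (f z))) (at (f z))"
    and ddg: "(fderiv g has_derivative blinfun_apply (fderiv (fderiv g) (f z))) (at (f z))"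
    if "z \<in> U" for z
    using f g fUV that by (auto simp: C2_on_def intro!: fderiv_has_derivative)
  have d1: "(g \<circ> f has_derivative blinfun_apply (fderiv g (f z) o\<^sub>L fderiv f z)) (at z)"
    if "z \<in> U" for z
    unfolding o_def
    by (rule has_derivative_eq_rhs[OF has_derivative_compose[OF df[OF that] dg[OF that]]])
      (simp add: fun_eq_iff)
  have e1: "fderiv (g \<circ> f) z = fderiv g (f z) o\<^sub>L fderiv f z" if "z \<in> U" for z
    by (rule fderiv_eqI[OF d1[OF that]])
  \<comment> \<open>The first summand is dg applied to d^2 f, the second is d^2 g with df in both
    slots. Building \<open>D\<close> from operators makes its continuity in operator norm follow
    from that of its ingredients.\<close>
  define D where "D z = (c.prod_right (fderiv g (f z)) o\<^sub>L fderiv (fderiv f) z)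
      + (c.prod_left (fderiv f z) o\<^sub>L (fderiv (fderiv g) (f z) o\<^sub>L fderiv f z))" for z
  have d2: "(fderiv (g \<circ> f) has_derivative blinfun_apply (D z)) (at z)" if z: "z \<in> U" for z
  proof -
    have "((\<lambda>w. fderiv g (f w) o\<^sub>L fderiv f w) has_derivative blinfun_apply (D z)) (at z)"
      using c.FDERIV[OF has_derivative_compose[OF df[OF z] ddg[OF z]] ddf[OF z]]
      by (rule has_derivative_eq_rhs)
        (simp add: D_def fun_eq_iff c.prod_left.rep_eq c.prod_right.rep_eq plus_blinfun.rep_eq)
    then show ?thesis
      by (rule has_derivative_transform_within_open[OF _ U z]) (simp add: e1)
  qed
  have e2: "fderiv (fderiv (g \<circ> f)) z = D z" if "z \<in> U" for z
    by (rule fderiv_eqI[OF d2[OF that]])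
  have "continuous_on U D"
  proof -
    note cf = C2_on_imp_continuous_on[OF f]
    have "continuous_on U (\<lambda>z. fderiv g (f z))" "continuous_on U (\<lambda>z. fderiv (fderiv g) (f z))"
      using C2_on_imp_continuous_on(2)[OF g] g
      by (auto intro: continuous_on_compose2[OF _ cf(1) fUV] simp: C2_on_def)
    moreover have "continuous_on U (fderiv (fderiv f))"
      using f by (simp add: C2_on_def)
    ultimately show ?thesis
      unfolding D_def
      by (intro continuous_on_add cf(2)
          bounded_bilinear.continuous_on[OF bounded_bilinear_blinfun_compose]
          bounded_linear.continuous_on[OF c.bounded_linear_prod_right]
          bounded_linear.continuous_on[OF c.bounded_linear_prod_left])
  qed
  then have "continuous_on U (fderiv (fderiv (g \<circ> f)))"
    by (rule continuous_on_eq) (simp add: e2)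
  then show "C2_on U (g \<circ> f)"
    unfolding C2_on_def using d1 d2 by (auto simp: differentiable_def)
  show "fderiv2 (g \<circ> f) x \<xi> \<eta> =
      fderiv2 g (f x) (fderiv f x \<xi>) (fderiv f x \<eta>) + fderiv g (f x) (fderiv2 f x \<xi> \<eta>)"
    if "x \<in> U"
    by (simp add: fderiv2_def e2[OF that] D_def c.prod_left.rep_eq c.prod_right.rep_eq
        plus_blinfun.rep_eq)
qed

text \<open>This is the mean value theorem in one real variable along the segment. The bound is
  asked only in the direction \<open>b - a\<close>, not for the operator norm, so an increment that
  is small in |.|_1 but large in |.|_2 can be exploited.\<close>

lemma norm_diff_le_along_segment:
  fixes f :: "'a::real_normed_vector \<Rightarrow> 'b::real_inner"
  assumes d: "\<And>z. z \<in> closed_segment a b \<Longrightarrow> (f has_derivative f' z) (at z)"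
    and B: "\<And>z. z \<in> closed_segment a b \<Longrightarrow> norm (f' z (b - a)) \<le> B"
  shows "norm (f b - f a) \<le> B"
proof -
  let ?l = "\<lambda>t::real. a + t *\<^sub>R (b - a)"
  have l: "?l t \<in> closed_segment a b" if "t \<in> {0..1}" for t
    using that by (auto simp: closed_segment_def algebra_simps intro!: exI[of _ t])
  have dl: "((\<lambda>t. f (?l t)) has_derivative (\<lambda>h. f' (?l t) (h *\<^sub>R (b - a)))) (at t)"
    if "t \<in> {0..1}" for t
    by (rule has_derivative_compose[where f = ?l, OF _ d[OF l[OF that]]])
      (auto intro!: derivative_eq_intros)
  have "continuous_on {0..1} (\<lambda>t. f (?l t))"
    using has_derivative_continuous[OF dl] by (intro continuous_at_imp_continuous_on) auto
  then obtain t where t: "t \<in> {0<..<1}"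
    and "norm (f (?l 1) - f (?l 0)) \<le> norm (f' (?l t) ((1 - 0) *\<^sub>R (b - a)))"
    using mvt_general[of 0 1 "\<lambda>t. f (?l t)" "\<lambda>t h. f' (?l t) (h *\<^sub>R (b - a))"] dl by auto
  then show ?thesis
    using B[OF l[of t]] by simp
qed

text \<open>Both derivatives are continuous in operator norm, so near \<open>x\<close> their norms
  stay below the values at \<open>x\<close> plus one.\<close>

lemma C2_on_locally_bounded:
  assumes "open U" "C2_on U f" "x \<in> U"
  obtains W C where "open W" "x \<in> W" "W \<subseteq> U" "C > 0"
    "\<And>y \<xi>. y \<in> W \<Longrightarrow> norm (fderiv f y \<xi>) \<le> C * norm \<xi>"
    "\<And>y \<xi> \<eta>. y \<in> W \<Longrightarrow> norm (fderiv2 f y \<xi> \<eta>) \<le> C * norm \<xi> * norm \<eta>"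
proof -
  define C where "C = norm (fderiv f x) + norm (fderiv (fderiv f) x) + 1"
  define W where "W = {y \<in> U. norm (fderiv f y) < C \<and> norm (fderiv (fderiv f) y) < C}"
  have c: "continuous_on U (\<lambda>y. norm (fderiv f y))"
    "continuous_on U (\<lambda>y. norm (fderiv (fderiv f) y))"
    using assms(2) C2_on_imp_continuous_on(2)[OF assms(2)]
    by (auto simp: C2_on_def intro!: continuous_on_norm)
  have "open (U \<inter> (\<lambda>y. norm (fderiv f y)) -` {..<C} \<inter>
      (U \<inter> (\<lambda>y. norm (fderiv (fderiv f) y)) -` {..<C}))"
    using assms(1) by (intro open_Int continuous_open_preimage c) auto
  also have "\<dots> = W"
    by (auto simp: W_def)
  finally have "open W" .
  moreover have "x \<in> W" "W \<subseteq> U" "C > 0"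
    using assms(3) by (auto simp: W_def C_def add_pos_nonneg add_nonneg_pos)
  moreover have "norm (fderiv f y \<xi>) \<le> C * norm \<xi>" if "y \<in> W" for y \<xi>
    using that by (intro order_trans[OF norm_blinfun] mult_right_mono) (auto simp: W_def)
  moreover have "norm (fderiv2 f y \<xi> \<eta>) \<le> C * norm \<xi> * norm \<eta>" if "y \<in> W" for y \<xi> \<eta>
  proof -
    have "norm (fderiv2 f y \<xi> \<eta>) \<le> norm (fderiv (fderiv f) y \<xi>) * norm \<eta>"
      unfolding fderiv2_def by (rule norm_blinfun)
    also have "\<dots> \<le> (norm (fderiv (fderiv f) y) * norm \<xi>) * norm \<eta>"
      by (intro mult_right_mono norm_blinfun) auto
    also have "\<dots> \<le> (C * norm \<xi>) * norm \<eta>"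
      using that by (intro mult_right_mono) (auto simp: W_def)
    finally show ?thesis .
  qed
  ultimately show ?thesis
    by (rule that)
qed

section \<open>Growth of tame maps\<close>

lemma restr2_eq:
  assumes "\<phi> ` (U \<inter> range \<iota>) \<subseteq> range \<iota>" "\<iota> y \<in> U"
  shows "\<iota> (restr2 \<iota> \<phi> y) = \<phi> (\<iota> y)"
  using assms by (auto simp: restr2_def intro!: f_inv_into_f)

text \<open>Both sides are derivatives of the same map from H_2 to H_1, hence equal by uniqueness.
  This lets operator bounds in H_1 control the |.|_1 norms of derivatives taken in H_2.\<close>

lemma fderiv_restr2:
  assumes bl: "bounded_linear \<iota>" and U: "open U" and t: "tame \<iota> U \<phi>" and y: "\<iota> y \<in> U"
  shows "\<iota> (fderiv (restr2 \<iota> \<phi>) y \<xi>) = fderiv \<phi> (\<iota> y) (\<iota> \<xi>)"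
proof -
  have op: "open (\<iota> -` U)"
    using U bl by (intro open_vimage) (auto intro: linear_continuous_on)
  have d: "(restr2 \<iota> \<phi> has_derivative fderiv (restr2 \<iota> \<phi>) y) (at y)"
    "(\<phi> has_derivative fderiv \<phi> (\<iota> y)) (at (\<iota> y))"
    using t y by (auto intro!: fderiv_has_derivative simp: tame_def C2_on_def)
  have "((\<lambda>w. \<phi> (\<iota> w)) has_derivative (\<lambda>h. fderiv \<phi> (\<iota> y) (\<iota> h))) (at y)"
    by (rule has_derivative_compose[OF bounded_linear_imp_has_derivative[OF bl] d(2)])
  then have "((\<lambda>w. \<iota> (restr2 \<iota> \<phi> w)) has_derivative (\<lambda>h. fderiv \<phi> (\<iota> y) (\<iota> h))) (at y)"
    by (rule has_derivative_transform_within_open[OF _ op])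
      (use t y in \<open>auto simp: restr2_eq tame_def\<close>)
  then show ?thesis
    using bounded_linear.has_derivative[OF bl d(1)] by (blast dest: has_derivative_unique fun_cong)
qed

text \<open>Tameness controls only the second derivative; the two lower orders are recovered by
  integration. The neighborhood is small in |.|_1 but unbounded in |.|_2, so linear growth in
  \<open>norm y\<close> is the form the bounds can take.\<close>

lemma tame_local_growth:
  fixes \<iota> :: "'h2::real_inner \<Rightarrow> 'h1::real_inner"
  assumes lin: "linear \<iota>" and dense: "closure (range \<iota>) = UNIV"
    and le: "\<And>x. norm (\<iota> x) \<le> norm x"
    and t: "tame \<iota> U \<phi>" and x: "x \<in> U"
  obtains W C where "open W" "x \<in> W" "W \<subseteq> U" "C > 0"
    "\<And>y. \<iota> y \<in> W \<Longrightarrow> norm (restr2 \<iota> \<phi> y) \<le> C * (1 + norm y)"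
    "\<And>y \<xi>. \<iota> y \<in> W \<Longrightarrow>
      norm (fderiv (restr2 \<iota> \<phi>) y \<xi>) \<le> C * (norm \<xi> + norm y * norm (\<iota> \<xi>))"
    "\<And>y \<xi> \<eta>. \<iota> y \<in> W \<Longrightarrow> norm (fderiv2 (restr2 \<iota> \<phi>) y \<xi> \<eta>)
      \<le> C * (norm (\<iota> \<xi>) * norm \<eta> + norm \<xi> * norm (\<iota> \<eta>) + norm y * norm (\<iota> \<xi>) * norm (\<iota> \<eta>))"
proof -
  let ?r = "restr2 \<iota> \<phi>"
  obtain W \<kappa> where W: "open W" "x \<in> W" "W \<subseteq> U" and \<kappa>: "\<kappa> > 0"
    and bd: "\<And>y \<xi> \<eta>. \<iota> y \<in> W \<Longrightarrow> norm (fderiv2 ?r y \<xi> \<eta>)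
      \<le> \<kappa> * (norm (\<iota> \<xi>) * norm \<eta> + norm \<xi> * norm (\<iota> \<eta>) + norm y * norm (\<iota> \<xi>) * norm (\<iota> \<eta>))"
    using t x unfolding tame_def by meson
  obtain e where e: "e > 0" "ball x e \<subseteq> W"
    using W openE by blast
  \<comment> \<open>Radius at most 1/2 keeps any two points of the ball at |.|_1 distance at most
    1.\<close>
  define d where "d = min e (1/2)"
  have d: "d > 0" "d \<le> 1/2" "ball x d \<subseteq> W"
    using e by (auto simp: d_def)
  have "x \<in> closure (range \<iota>)"
    using dense by simp
  \<comment> \<open>The center \<open>x\<close> need not lie in the range of \<iota>, so density
    supplies a base point of H_2 for the segments.\<close>
  then obtain p where p: "\<iota> p \<in> ball x d"
    using d(1) by (auto simp: closure_approachable dist_commute)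
  have seg: "\<iota> z \<in> ball x d \<and> norm z \<le> norm p + norm y"
    if "\<iota> y \<in> ball x d" "z \<in> closed_segment p y" for y z
  proof
    have "\<iota> z \<in> closed_segment (\<iota> p) (\<iota> y)"
      using that(2) closed_segment_linear_image[OF lin, of p y] by blast
    then show "\<iota> z \<in> ball x d"
      using closed_segment_subset[OF p that(1) convex_ball] by blast
    have "z \<in> cball 0 (norm p + norm y)"
      using closed_segment_subset[of p "cball 0 (norm p + norm y)" y] that(2) by auto
    then show "norm z \<le> norm p + norm y"
      by simp
  qed
  have close: "norm (\<iota> (y - p)) \<le> 1" if "\<iota> y \<in> ball x d" for y
  proof -
    have "dist (\<iota> y) (\<iota> p) \<le> dist x (\<iota> y) + dist x (\<iota> p)"
      by (rule dist_triangle3)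
    then show ?thesis
      using p that d(2) by (simp add: dist_norm linear_diff[OF lin])
  qed
  have dr: "(?r has_derivative fderiv ?r z) (at z)"
    "(fderiv ?r has_derivative fderiv (fderiv ?r) z) (at z)" if z: "\<iota> z \<in> ball x d" for z
  proof -
    have "z \<in> \<iota> -` U"
      using z W(3) d(3) by blast
    then show "(?r has_derivative fderiv ?r z) (at z)"
      "(fderiv ?r has_derivative fderiv (fderiv ?r) z) (at z)"
      using t by (auto intro!: fderiv_has_derivative simp: tame_def C2_on_def)
  qed
  \<comment> \<open>The coefficient of \<open>norm \<xi>\<close> needs \<kappa> (1 + 2 |p|_2) plus
    the operator norm at \<open>p\<close>. The further \<kappa> ensures
    \<open>C \<ge> 2 * \<kappa>\<close>, the coefficient of
    \<open>norm y * norm (\<iota> \<xi>)\<close>.\<close>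
  define C where "C = \<kappa> * (2 + 2 * norm p) + norm (fderiv ?r p)"
  have C: "C \<ge> 2 * \<kappa>"
    using \<kappa> by (simp add: C_def algebra_simps)
  have d_bd: "norm (fderiv ?r y \<xi>) \<le> C * (norm \<xi> + norm y * norm (\<iota> \<xi>))"
    if y: "\<iota> y \<in> ball x d" for y \<xi>
  proof -
    have "norm (fderiv ?r y \<xi> - fderiv ?r p \<xi>)
      \<le> \<kappa> * (norm \<xi> + 2 * (norm p + norm y) * norm (\<iota> \<xi>))"
    proof (rule norm_diff_le_along_segment[where f = "\<lambda>z. fderiv ?r z \<xi>"
          and f' = "\<lambda>z h. fderiv2 ?r z h \<xi>"])
      fix z assume z: "z \<in> closed_segment p y"
      show "((\<lambda>z. fderiv ?r z \<xi>) has_derivative (\<lambda>h. fderiv2 ?r z h \<xi>)) (at z)"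
        unfolding fderiv2_def using seg[OF y z]
        by (intro bounded_linear.has_derivative[OF blinfun.bounded_linear_left] dr(2)) simp
      have "norm (fderiv2 ?r z (y - p) \<xi>) \<le> \<kappa> * (norm (\<iota> (y - p)) * norm \<xi>
          + norm (y - p) * norm (\<iota> \<xi>) + norm z * norm (\<iota> (y - p)) * norm (\<iota> \<xi>))"
        using seg[OF y z] d(3) by (intro bd) auto
      \<comment> \<open>The length of the segment enters the last term through |.|_1, where it is at
        most 1. Hence |z|_2 is never multiplied by |y - p|_2, and the bound stays linear in
        \<open>norm y\<close>.\<close>
      also have "\<dots> \<le> \<kappa> * (1 * norm \<xi> + (norm p + norm y) * norm (\<iota> \<xi>)
          + (norm p + norm y) * 1 * norm (\<iota> \<xi>))"
        using \<kappa> close[OF y] seg[OF y z] norm_triangle_ineq4[of y p]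
        by (intro mult_left_mono add_mono mult_mono) auto
      finally show "norm (fderiv2 ?r z (y - p) \<xi>)
          \<le> \<kappa> * (norm \<xi> + 2 * (norm p + norm y) * norm (\<iota> \<xi>))"
        by (simp add: algebra_simps)
    qed
    moreover have "\<kappa> * (2 * norm p * norm (\<iota> \<xi>)) \<le> \<kappa> * (2 * norm p * norm \<xi>)"
      using \<kappa> le by (intro mult_left_mono) auto
    moreover have "norm (fderiv ?r p \<xi>) \<le> norm (fderiv ?r p) * norm \<xi>"
      by (rule norm_blinfun)
    moreover have "2 * \<kappa> * (norm y * norm (\<iota> \<xi>)) \<le> C * (norm y * norm (\<iota> \<xi>))"
      by (intro mult_right_mono C) auto
    moreover have "norm (fderiv ?r y \<xi>)
        \<le> norm (fderiv ?r p \<xi>) + norm (fderiv ?r y \<xi> - fderiv ?r p \<xi>)"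
      by (rule norm_triangle_sub)
    moreover have "C * norm \<xi> = \<kappa> * norm \<xi> + \<kappa> * norm \<xi> + \<kappa> * (2 * norm p * norm \<xi>)
        + norm (fderiv ?r p) * norm \<xi>" "\<kappa> * norm \<xi> \<ge> 0"
      using \<kappa> by (simp_all add: C_def algebra_simps)
    ultimately show ?thesis
      by (simp add: algebra_simps)
  qed
  \<comment> \<open>This covers the constant part |r(p)|_2 + 2 C |p|_2 and the slope 2 C of the
    integrated bound. It also dominates \<open>C\<close> and \<kappa>, so one constant serves all
    three estimates.\<close>
  define C' where "C' = norm (?r p) + 2 * C * (norm p + 1)"
  have C_pos: "C > 0"
    using C \<kappa> by simp
  have C'_ge: "C' \<ge> 2 * C"
    using C_pos by (simp add: C'_def algebra_simps)
  have r_bd: "norm (?r y) \<le> C' * (1 + norm y)" if y: "\<iota> y \<in> ball x d" for y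
  proof -
    have "norm (?r y - ?r p) \<le> C * (2 * (norm p + norm y))"
    proof (rule norm_diff_le_along_segment[where f = ?r and f' = "\<lambda>z. fderiv ?r z"])
      fix z assume z: "z \<in> closed_segment p y"
      show "(?r has_derivative fderiv ?r z) (at z)"
        using seg[OF y z] by (intro dr(1)) simp
      have "norm (fderiv ?r z (y - p)) \<le> C * (norm (y - p) + norm z * norm (\<iota> (y - p)))"
        using seg[OF y z] by (intro d_bd) simp
      \<comment> \<open>Again |z|_2 is paired with |y - p|_1, which avoids a quadratic term in
        \<open>norm y\<close>.\<close>
      also have "\<dots> \<le> C * ((norm p + norm y) + (norm p + norm y) * 1)"
        using C_pos close[OF y] seg[OF y z] norm_triangle_ineq4[of y p]
        by (intro mult_left_mono add_mono mult_mono) auto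
      finally show "norm (fderiv ?r z (y - p)) \<le> C * (2 * (norm p + norm y))"
        by (simp add: algebra_simps)
    qed
    moreover have "norm (?r y) \<le> norm (?r p) + norm (?r y - ?r p)"
      by (rule norm_triangle_sub)
    moreover have "2 * C * norm y \<le> C' * norm y"
      by (intro mult_right_mono C'_ge) auto
    moreover have "norm (?r p) + 2 * C * norm p \<le> C'"
      using C_pos by (simp add: C'_def algebra_simps)
    ultimately show ?thesis
      by (simp add: algebra_simps)
  qed
  have mono: "K * s \<le> C' * s" if "K \<le> C'" "s \<ge> 0" for K s
    using that by (rule mult_right_mono)
  show thesis
  proof (rule that[of "ball x d" C'])
    show "ball x d \<subseteq> U" "open (ball x d)" "x \<in> ball x d" "C' > 0"
      using d W C'_ge C_pos by auto
    show "norm (?r y) \<le> C' * (1 + norm y)" if "\<iota> y \<in> ball x d" for y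
      using that by (rule r_bd)
    show "norm (fderiv ?r y \<xi>) \<le> C' * (norm \<xi> + norm y * norm (\<iota> \<xi>))"
      if "\<iota> y \<in> ball x d" for y \<xi>
      using C'_ge C_pos by (intro order_trans[OF d_bd[OF that] mono]) auto
    show "norm (fderiv2 ?r y \<xi> \<eta>)
      \<le> C' * (norm (\<iota> \<xi>) * norm \<eta> + norm \<xi> * norm (\<iota> \<eta>) + norm y * norm (\<iota> \<xi>) * norm (\<iota> \<eta>))"
      if "\<iota> y \<in> ball x d" for y \<xi> \<eta>
    proof -
      have "\<iota> y \<in> W"
        using that d(3) by blast
      then show ?thesis
        using C'_ge C C_pos \<kappa> by (intro order_trans[OF bd mono]) auto
    qed
  qed
qed

section \<open>Composition\<close>

theorem theorem2p5:
  fixes \<iota> :: "'h2::{real_inner, complete_space} \<Rightarrow> 'h1::{real_inner, complete_space}"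
    and U1 V1 :: "'h1 set"
    and \<phi> \<psi> :: "'h1 \<Rightarrow> 'h1"
  assumes "separable_space (euclidean :: 'h1 topology)"
    and "separable_space (euclidean :: 'h2 topology)"
    and "linear \<iota>" and "inj \<iota>" and "closure (range \<iota>) = UNIV"
    and "\<And>x. norm (\<iota> x) \<le> norm x"
    and "open U1" and "open V1"
    and "\<phi> ` U1 \<subseteq> V1"
    and "tame \<iota> U1 \<phi>" and "tame \<iota> V1 \<psi>"
  shows "tame \<iota> U1 (\<psi> \<circ> \<phi>)"
proof -
  let ?f = "restr2 \<iota> \<phi>" and ?g = "restr2 \<iota> \<psi>"
  have bl: "bounded_linear \<iota>"
    using assms(3,6) by (intro bounded_linear_intro[where K = 1]) (auto simp: linear_add linear_scale)
  have op: "open (\<iota> -` U1)"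
    using assms(7) bl by (intro open_vimage) (auto intro: linear_continuous_on)
  have f1: "C2_on U1 \<phi>" "\<phi> ` (U1 \<inter> range \<iota>) \<subseteq> range \<iota>" "C2_on (\<iota> -` U1) ?f"
    and g1: "C2_on V1 \<psi>" "\<psi> ` (V1 \<inter> range \<iota>) \<subseteq> range \<iota>" "C2_on (\<iota> -` V1) ?g"
    using assms(10,11) by (auto simp: tame_def)
  have \<iota>f: "\<iota> (?f y) = \<phi> (\<iota> y)" if "\<iota> y \<in> U1" for y
    using restr2_eq[OF f1(2) that] .
  have sub: "?f ` (\<iota> -` U1) \<subseteq> \<iota> -` V1"
    using \<iota>f assms(9) by auto
  \<comment> \<open>Inside the preimage, \<open>\<iota>f\<close> cancels the inner
    \<open>inv \<iota>\<close>, so the chain rule can be applied entirely within H_2.\<close>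
  have eq: "(?g \<circ> ?f) y = restr2 \<iota> (\<psi> \<circ> \<phi>) y" if "y \<in> \<iota> -` U1" for y
    using \<iota>f that by (simp add: restr2_def[of \<iota> \<psi>] restr2_def[of \<iota> "\<psi> \<circ> \<phi>"])
  note C2_gf = C2_on_compose[OF op f1(3) g1(3) sub]
  have d2: "fderiv2 (restr2 \<iota> (\<psi> \<circ> \<phi>)) y \<xi> \<eta> =
      fderiv2 ?g (?f y) (fderiv ?f y \<xi>) (fderiv ?f y \<eta>) + fderiv ?g (?f y) (fderiv2 ?f y \<xi> \<eta>)"
    if "\<iota> y \<in> U1" for y \<xi> \<eta>
    using fderiv_fderiv_cong_open(2)[OF op eq C2_gf(1)] C2_gf(2) that by (simp add: fderiv2_def)
  have "\<exists>W \<kappa>. open W \<and> x \<in> W \<and> W \<subseteq> U1 \<and> \<kappa> > 0 \<and>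
        (\<forall>y \<xi> \<eta>. \<iota> y \<in> W \<longrightarrow>
           norm (fderiv2 (restr2 \<iota> (\<psi> \<circ> \<phi>)) y \<xi> \<eta>)
             \<le> \<kappa> * (norm (\<iota> \<xi>) * norm \<eta> + norm \<xi> * norm (\<iota> \<eta>)
                     + norm y * norm (\<iota> \<xi>) * norm (\<iota> \<eta>)))" if x: "x \<in> U1" for x
  proof -
    obtain W1 C where W1: "open W1" "x \<in> W1" "W1 \<subseteq> U1" and C: "C > 0"
      and f: "\<And>y. \<iota> y \<in> W1 \<Longrightarrow> norm (?f y) \<le> C * (1 + norm y)"
      and df: "\<And>y \<xi>. \<iota> y \<in> W1 \<Longrightarrow>
        norm (fderiv ?f y \<xi>) \<le> C * (norm \<xi> + norm y * norm (\<iota> \<xi>))"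
      and ddf: "\<And>y \<xi> \<eta>. \<iota> y \<in> W1 \<Longrightarrow> norm (fderiv2 ?f y \<xi> \<eta>)
        \<le> C * (norm (\<iota> \<xi>) * norm \<eta> + norm \<xi> * norm (\<iota> \<eta>) + norm y * norm (\<iota> \<xi>) * norm (\<iota> \<eta>))"
      by (rule tame_local_growth[OF assms(3,5,6,10) x], erule (3) that) assumption+
    have \<phi>x: "\<phi> x \<in> V1"
      using x assms(9) by blast
    obtain W2 E where W2: "open W2" "\<phi> x \<in> W2" "W2 \<subseteq> V1" and E: "E > 0"
      and dg: "\<And>z \<zeta>. \<iota> z \<in> W2 \<Longrightarrow>
        norm (fderiv ?g z \<zeta>) \<le> E * (norm \<zeta> + norm z * norm (\<iota> \<zeta>))"
      and ddg: "\<And>z \<zeta> \<theta>. \<iota> z \<in> W2 \<Longrightarrow> norm (fderiv2 ?g z \<zeta> \<theta>)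
        \<le> E * (norm (\<iota> \<zeta>) * norm \<theta> + norm \<zeta> * norm (\<iota> \<theta>) + norm z * norm (\<iota> \<zeta>) * norm (\<iota> \<theta>))"
      by (rule tame_local_growth[OF assms(3,5,6,11) \<phi>x], erule (3) that) assumption+
    \<comment> \<open>Bounds in H_1 are needed besides the growth estimates: they control |.|_1
      norms of derivatives by |.|_1 norms of the arguments, without a factor
      \<open>norm y\<close>.\<close>
    obtain W3 M where W3: "open W3" "x \<in> W3" "W3 \<subseteq> U1" and M: "M > 0"
      and d\<phi>: "\<And>y \<xi>. y \<in> W3 \<Longrightarrow> norm (fderiv \<phi> y \<xi>) \<le> M * norm \<xi>"
      and dd\<phi>: "\<And>y \<xi> \<eta>. y \<in> W3 \<Longrightarrow> norm (fderiv2 \<phi> y \<xi> \<eta>) \<le> M * norm \<xi> * norm \<eta>"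
      by (rule C2_on_locally_bounded[OF assms(7) f1(1) x], erule (3) that) assumption+
    \<comment> \<open>The preimage of \<open>W2\<close> guarantees that the estimates for \<psi> may
      be used at \<open>?f y\<close>.\<close>
    define W where "W = W1 \<inter> W3 \<inter> (U1 \<inter> \<phi> -` W2)"
    \<comment> \<open>The first bracket collects the three terms of the estimate for d^2 \<psi>
      (\<open>t1\<close>, \<open>t2\<close>, \<open>t3\<close>), the second the two terms of the
      estimate for d\<psi> (\<open>w2\<close>, \<open>t4\<close>).\<close>
    define K where "K = E * (M * C + M * C + C * M * M) + E * (C + C * M)"
    have "open W"
      unfolding W_def
      by (intro open_Int continuous_open_preimage C2_on_imp_continuous_on(1)[OF f1(1)]
          assms(7) W1(1) W2(1) W3(1))
    then have W: "open W" "x \<in> W" "W \<subseteq> U1"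
      using W1 W2 W3 x by (auto simp: W_def)
    have "K > 0"
      unfolding K_def using C E M by (intro add_pos_pos mult_pos_pos)
    moreover have "norm (fderiv2 (restr2 \<iota> (\<psi> \<circ> \<phi>)) y \<xi> \<eta>)
             \<le> K * (norm (\<iota> \<xi>) * norm \<eta> + norm \<xi> * norm (\<iota> \<eta>)
                     + norm y * norm (\<iota> \<xi>) * norm (\<iota> \<eta>))"
      (is "_ \<le> K * ?T") if y: "\<iota> y \<in> W" for y \<xi> \<eta>
    proof -
      have y': "\<iota> y \<in> W1" "\<iota> y \<in> W3" "\<iota> y \<in> U1" "\<iota> (?f y) \<in> W2"
        using y \<iota>f W(3) by (auto simp: W_def)
      define u v w where "u = fderiv ?f y \<xi>" and "v = fderiv ?f y \<eta>" and "w = fderiv2 ?f y \<xi> \<eta>"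
      have u1: "norm (\<iota> u) \<le> M * norm (\<iota> \<xi>)" and v1: "norm (\<iota> v) \<le> M * norm (\<iota> \<eta>)"
        unfolding u_def v_def fderiv_restr2[OF bl assms(7,10) y'(3)] by (intro d\<phi> y')+
      have w1: "norm (\<iota> w) \<le> M * norm (\<iota> \<xi>) * norm (\<iota> \<eta>)"
        unfolding w_def tame_fderiv2[OF bl assms(4,7,10) y'(3)] by (intro dd\<phi> y')
      have u2: "norm u \<le> C * (norm \<xi> + norm y * norm (\<iota> \<xi>))"
        and v2: "norm v \<le> C * (norm \<eta> + norm y * norm (\<iota> \<eta>))"
        unfolding u_def v_def by (intro df y')+
      have w2: "norm w \<le> C * ?T"
        unfolding w_def by (intro ddf y')
      have fy: "norm (?f y) \<le> C * (1 + norm y)"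
        by (intro f y')
      let ?ab = "norm (\<iota> \<xi>) * norm (\<iota> \<eta>)"
      \<comment> \<open>Since |.|_1 is at most |.|_2, a product of two |.|_1 norms is absorbed by a
        mixed product. This accounts for the 1 in the growth factor
        \<open>1 + norm y\<close>.\<close>
      have "?ab \<le> norm (\<iota> \<xi>) * norm \<eta>" "?ab \<le> norm \<xi> * norm (\<iota> \<eta>)"
        using assms(6) by (auto intro: mult_left_mono mult_right_mono)
      then have low: "(1 + norm y) * ?ab \<le> ?T"
        "norm (\<iota> \<xi>) * (norm \<eta> + norm y * norm (\<iota> \<eta>)) \<le> ?T"
        "(norm \<xi> + norm y * norm (\<iota> \<xi>)) * norm (\<iota> \<eta>) \<le> ?T"
        by (auto simp: algebra_simps intro: add_increasing)
      \<comment> \<open>In each of the four products exactly one factor is measured in |.|_2, and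
        the others by the H_1 bounds, so \<open>norm y\<close> occurs at most to the first
        power.\<close>
      have t1: "norm (\<iota> u) * norm v \<le> M * C * ?T"
      proof -
        have "norm (\<iota> u) * norm v
            \<le> (M * norm (\<iota> \<xi>)) * (C * (norm \<eta> + norm y * norm (\<iota> \<eta>)))"
          using M by (intro mult_mono u1 v2) auto
        also have "\<dots> = M * C * (norm (\<iota> \<xi>) * (norm \<eta> + norm y * norm (\<iota> \<eta>)))"
          by simp
        also have "\<dots> \<le> M * C * ?T"
          using M C by (intro mult_left_mono low) auto
        finally show ?thesis .
      qed
      have t2: "norm u * norm (\<iota> v) \<le> M * C * ?T"
      proof -
        have "norm u * norm (\<iota> v)
            \<le> (C * (norm \<xi> + norm y * norm (\<iota> \<xi>))) * (M * norm (\<iota> \<eta>))"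
          using C by (intro mult_mono u2 v1) auto
        also have "\<dots> = M * C * ((norm \<xi> + norm y * norm (\<iota> \<xi>)) * norm (\<iota> \<eta>))"
          by simp
        also have "\<dots> \<le> M * C * ?T"
          using M C by (intro mult_left_mono low) auto
        finally show ?thesis .
      qed
      have t3: "norm (?f y) * norm (\<iota> u) * norm (\<iota> v) \<le> C * M * M * ?T"
      proof -
        have "norm (?f y) * norm (\<iota> u) * norm (\<iota> v)
            \<le> (C * (1 + norm y)) * (M * norm (\<iota> \<xi>)) * (M * norm (\<iota> \<eta>))"
          using C M by (intro mult_mono u1 v1 fy) auto
        also have "\<dots> = C * M * M * ((1 + norm y) * ?ab)"
          by simp
        also have "\<dots> \<le> C * M * M * ?T"
          using M C by (intro mult_left_mono low) auto
        finally show ?thesis .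
      qed
      have t4: "norm (?f y) * norm (\<iota> w) \<le> C * M * ?T"
      proof -
        have "norm (?f y) * norm (\<iota> w)
            \<le> (C * (1 + norm y)) * (M * norm (\<iota> \<xi>) * norm (\<iota> \<eta>))"
          using C by (intro mult_mono w1 fy) auto
        also have "\<dots> = C * M * ((1 + norm y) * ?ab)"
          by simp
        also have "\<dots> \<le> C * M * ?T"
          using M C by (intro mult_left_mono low) auto
        finally show ?thesis .
      qed
      have "norm (fderiv2 (restr2 \<iota> (\<psi> \<circ> \<phi>)) y \<xi> \<eta>)
          \<le> norm (fderiv2 ?g (?f y) u v) + norm (fderiv ?g (?f y) w)"
        unfolding d2[OF y'(3)] u_def v_def w_def by (rule norm_triangle_ineq)
      also have "\<dots> \<le> E * (norm (\<iota> u) * norm v + norm u * norm (\<iota> v)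
            + norm (?f y) * norm (\<iota> u) * norm (\<iota> v)) + E * (norm w + norm (?f y) * norm (\<iota> w))"
        by (intro add_mono ddg dg y')
      also have "\<dots> \<le> E * (M * C * ?T + M * C * ?T + C * M * M * ?T) + E * (C * ?T + C * M * ?T)"
        using E by (intro add_mono mult_left_mono t1 t2 t3 t4 w2) auto
      also have "\<dots> = K * ?T"
        by (simp add: K_def algebra_simps)
      finally show ?thesis .
    qed
    ultimately show ?thesis
      using W by blast
  qed
  moreover have "C2_on U1 (\<psi> \<circ> \<phi>)"
    by (rule C2_on_compose(1)[OF assms(7) f1(1) g1(1) assms(9)])
  moreover have "C2_on (\<iota> -` U1) (restr2 \<iota> (\<psi> \<circ> \<phi>))"
    using op eq C2_gf(1) by (rule C2_on_cong_open)
  moreover have "(\<psi> \<circ> \<phi>) ` (U1 \<inter> range \<iota>) \<subseteq> range \<iota>"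
  proof (rule image_subsetI)
    fix z assume z: "z \<in> U1 \<inter> range \<iota>"
    then have "\<phi> z \<in> V1 \<inter> range \<iota>"
      using f1(2) assms(9) by blast
    then show "(\<psi> \<circ> \<phi>) z \<in> range \<iota>"
      using g1(2) by auto
  qed
  ultimately show ?thesis
    by (simp add: tame_def)
qed

end
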